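(* For every graph $G$, $$Z(G)\leq \sum_{u\in V(G)}\ \sum_{i=0}^{d_G(u)}(-1)^i\sum_{I\in \binom{N_G(u)}{i}}\left|\{u\}\cup\bigcup_{v\in I}N_G[v]\right|^{-1}.$$
   Context: All graphs are finite, simple and undirected. $N_G(u)$ is the set of neighbors of $u$, $N_G[v]=N_G(v)\cup\{v\}$ the closed neighborhood, and $d_G(u)=|N_G(u)|$. For a set $N$ and integer $i\geq 0$, $\binom{N}{i}$ denotes the set of all $i$-element subsets of $N$ (for $I=\emptyset$ the union is empty, so the term is $1$). For a set $Z\subseteq V(G)$, let $\mathcal{F}(Z)$ be the set obtained from $Z$ by repeatedly adding a vertex $u$ outside the current set whenever $u$ is the unique neighbor outside the current set of some vertex in the current set, as long as possible. $Z$ is a zero forcing set of $G$ if $\mathcal{F}(Z)=V(G)$. The zero forcing number $Z(G)$ is the minimum cardinality of a zero forcing set of $G$. *)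

theory Defs
  imports Complex_Main "Graph_Theory.Pair_Digraph"
begin

text \<open>
  Finite simple undirected graphs are the locale \<open>pair_graph\<close>: finitely many vertices and a
  symmetric irreflexive set of arcs, each edge being represented by both of its orientations.
\<close>

definition nbhd :: "'a pair_pre_digraph \<Rightarrow> 'a \<Rightarrow> 'a set" where
  "nbhd G u = {v. (u, v) \<in> parcs G}"

definition closed_nbhd :: "'a pair_pre_digraph \<Rightarrow> 'a \<Rightarrow> 'a set" where
  "closed_nbhd G v = nbhd G v \<union> {v}"

definition degree :: "'a pair_pre_digraph \<Rightarrow> 'a \<Rightarrow> nat" where
  "degree G u = card (nbhd G u)"

definition force_step :: "'a pair_pre_digraph \<Rightarrow> 'a set \<Rightarrow> 'a set \<Rightarrow> bool" where
  "force_step G S T \<longleftrightarrow> (\<exists>v\<in>S. \<exists>u. nbhd G v - S = {u} \<and> T = insert u S)"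

text \<open>
  The forcing process is nondeterministic, but its outcome does not depend on the choices made;
  see \<open>forcing_closure_unique\<close> below.
\<close>

definition forcing_closure :: "'a pair_pre_digraph \<Rightarrow> 'a set \<Rightarrow> 'a set" where
  "forcing_closure G Z = (THE T. (force_step G)\<^sup>*\<^sup>* Z T \<and> (\<nexists>U. force_step G T U))"

definition zero_forcing_set :: "'a pair_pre_digraph \<Rightarrow> 'a set \<Rightarrow> bool" where
  "zero_forcing_set G Z \<longleftrightarrow> Z \<subseteq> pverts G \<and> forcing_closure G Z = pverts G"

definition zero_forcing_number :: "'a pair_pre_digraph \<Rightarrow> nat" where
  "zero_forcing_number G = (LEAST k. \<exists>Z. zero_forcing_set G Z \<and> card Z = k)"

lemma force_steps_mono: "(force_step G)\<^sup>*\<^sup>* S T \<Longrightarrow> S \<subseteq> T"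
  by (induction rule: rtranclp_induct) (auto simp: force_step_def)

lemma force_steps_subset_stalled:
  assumes "(force_step G)\<^sup>*\<^sup>* Z S" and "Z \<subseteq> T" and stalled: "\<nexists>U. force_step G T U"
  shows "S \<subseteq> T"
  using assms(1)
proof (induction rule: rtranclp_induct)
  case base
  show ?case by fact
next
  case (step S S')
  from step.hyps(2) obtain v u
    where v: "v \<in> S" and u: "nbhd G v - S = {u}" and S': "S' = insert u S"
    by (auto simp: force_step_def)
  have "u \<in> T"
  proof (rule ccontr)
    assume "u \<notin> T"
    with u step.IH have "nbhd G v - T = {u}" by blast
    with v step.IH have "force_step G T (insert u T)"
      by (auto simp: force_step_def)
    with stalled show False by blast
  qed
  with S' step.IH show ?case by simp
qed

lemma (in pair_graph) force_step_verts:
  assumes "force_step G S T" "S \<subseteq> pverts G"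
  shows "T \<subseteq> pverts G" "card (pverts G - T) < card (pverts G - S)"
proof -
  from assms(1) obtain v u where vu: "nbhd G v - S = {u}" "T = insert u S"
    by (auto simp: force_step_def)
  then have "u \<in> nbhd G v" and "u \<notin> S" by blast+
  then have "u \<in> pverts G" by (auto simp: nbhd_def dest: in_arcsD2)
  with vu assms(2) show "T \<subseteq> pverts G" by simp
  have "pverts G - T \<subset> pverts G - S"
    using \<open>u \<in> pverts G\<close> \<open>u \<notin> S\<close> vu(2) by blast
  then show "card (pverts G - T) < card (pverts G - S)"
    by (intro psubset_card_mono finite_Diff pair_finite_verts)
qed

lemma (in pair_graph) forcing_terminates:
  assumes "Z \<subseteq> pverts G"
  shows "\<exists>T. (force_step G)\<^sup>*\<^sup>* Z T \<and> (\<nexists>U. force_step G T U)"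
  using assms
proof (induction "card (pverts G - Z)" arbitrary: Z rule: less_induct)
  case less
  show ?case
  proof (cases "\<exists>U. force_step G Z U")
    case True
    then obtain U where U: "force_step G Z U" by blast
    from less.hyps[OF force_step_verts(2)[OF U less.prems] force_step_verts(1)[OF U less.prems]]
    show ?thesis using U by (meson converse_rtranclp_into_rtranclp)
  qed blast
qed

lemma (in pair_graph) forcing_closure_unique:
  assumes "Z \<subseteq> pverts G"
  shows "\<exists>!T. (force_step G)\<^sup>*\<^sup>* Z T \<and> (\<nexists>U. force_step G T U)"
proof (rule ex_ex1I)
  show "\<exists>T. (force_step G)\<^sup>*\<^sup>* Z T \<and> (\<nexists>U. force_step G T U)"
    using assms by (rule forcing_terminates)
next
  fix S T
  assume "(force_step G)\<^sup>*\<^sup>* Z S \<and> (\<nexists>U. force_step G S U)"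
    and "(force_step G)\<^sup>*\<^sup>* Z T \<and> (\<nexists>U. force_step G T U)"
  then show "S = T"
    by (meson equalityI force_steps_mono force_steps_subset_stalled)
qed

end

theory Submission
  imports Defs "HOL-Combinatorics.Permutations"
begin

text \<open>
  Order the vertices uniformly at random and let \<open>Z\<close> consist of all vertices \<open>u\<close> that are not the
  last element of \<open>N[v]\<close> for any neighbour \<open>v\<close> of \<open>u\<close>. Going through the vertices in this order,
  a vertex \<open>u\<close> outside \<open>Z\<close> that is last in \<open>N[v]\<close> can be forced by \<open>v\<close>, so \<open>Z\<close> is a zero forcing
  set. A vertex \<open>u\<close> is last in \<open>N[v]\<close> for all \<open>v \<in> I\<close> exactly if it is last in the union of \<open>{u}\<close>
  and these sets, which has probability one over its cardinality; inclusion-exclusion over the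
  subsets \<open>I\<close> of \<open>N(u)\<close> therefore turns the expected size of \<open>Z\<close> into the right-hand side.
\<close>

lemma card_filter_conv_sum_of_bool:
  assumes "finite S"
  shows "real (card {x\<in>S. P x}) = (\<Sum>x\<in>S. of_bool (P x))"
proof -
  have "{x\<in>S. P x} = S \<inter> {x. P x}"
    by blast
  with assms show ?thesis
    by simp
qed

text \<open>For each \<open>x\<close>, the indicator that no \<open>P v x\<close> holds is the
  product over \<open>N\<close> of the factors 1 minus the indicator of \<open>P v x\<close>.
  Expanding this product over subsets of \<open>N\<close> and swapping sums gives the
  formula.\<close>

lemma card_none_inclusion_exclusion:
  assumes "finite S" "finite N"
  shows "real (card {x\<in>S. \<forall>v\<in>N. \<not> P v x}) =
    (\<Sum>I\<in>Pow N. (-1) ^ card I * real (card {x\<in>S. \<forall>v\<in>I. P v x}))"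
proof -
  have *: "(\<Prod>v\<in>I. of_bool (Q v)) = (of_bool (\<forall>v\<in>I. Q v) :: real)" if "finite I" for I and Q :: "_ \<Rightarrow> bool"
    using that by (induction I) auto
  have "real (card {x\<in>S. \<forall>v\<in>N. \<not> P v x}) = (\<Sum>x\<in>S. \<Prod>v\<in>N. 1 - of_bool (P v x))"
    by (simp only: card_filter_conv_sum_of_bool[OF assms(1)] of_bool_not_iff[symmetric] *[OF assms(2)])
  also have "\<dots> = (\<Sum>x\<in>S. \<Sum>I\<in>Pow N. (-1) ^ card I * of_bool (\<forall>v\<in>I. P v x))"
    by (intro sum.cong refl, subst prod_diff_conv_sum[OF assms(2)], intro sum.cong refl)
      (simp add: * finite_subset[OF _ assms(2)])
  also have "\<dots> = (\<Sum>I\<in>Pow N. (-1) ^ card I * (\<Sum>x\<in>S. of_bool (\<forall>v\<in>I. P v x)))"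
    by (subst sum.swap) (simp add: sum_distrib_left)
  finally show ?thesis
    by (simp only: card_filter_conv_sum_of_bool[OF assms(1)])
qed

text \<open>Regroups the subset sum of inclusion-exclusion by size, as in the double sum of the
  theorem.\<close>

lemma sum_Pow_by_card:
  fixes f :: "nat \<Rightarrow> 'b::semiring_0"
  assumes "finite N"
  shows "(\<Sum>I\<in>Pow N. f (card I) * g I) =
    (\<Sum>i=0..card N. f i * (\<Sum>I\<in>{I. I \<subseteq> N \<and> card I = i}. g I))"
    (is "?L = _")
proof -
  have "?L = (\<Sum>i\<in>{0..card N}. \<Sum>I | I \<in> Pow N \<and> card I = i. f (card I) * g I)"
    by (rule sum.group[symmetric]) (use assms in \<open>auto intro: card_mono\<close>)
  also have "\<dots> = (\<Sum>i=0..card N. f i * (\<Sum>I\<in>{I. I \<subseteq> N \<and> card I = i}. g I))"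
    by (simp add: sum_distrib_left)
  finally show ?thesis .
qed

text \<open>Precomposition with the transposition of \<open>u\<close> and \<open>w\<close> is an
  involution. As it maps \<open>A\<close> to itself, it exchanges the two sets.\<close>

lemma card_permutes_max_eq:
  fixes h :: "'a \<Rightarrow> 'b::linorder"
  assumes "A \<subseteq> V" "u \<in> A" "w \<in> A"
  shows "card {p. p permutes V \<and> (\<forall>x\<in>A. h (p x) \<le> h (p u))} =
    card {p. p permutes V \<and> (\<forall>x\<in>A. h (p x) \<le> h (p w))}"
proof (rule bij_betw_same_card)
  let ?t = "\<lambda>p. p \<circ> transpose u w"
  have t: "transpose u w permutes V"
    using assms by (intro permutes_swap_id) auto
  have A: "transpose u w x \<in> A" if "x \<in> A" for x
    using that assms by (auto simp: transpose_def)
  show "bij_betw ?t {p. p permutes V \<and> (\<forall>x\<in>A. h (p x) \<le> h (p u))}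
    {p. p permutes V \<and> (\<forall>x\<in>A. h (p x) \<le> h (p w))}"
    by (rule bij_betw_byWitness[where f' = ?t])
      (auto simp: comp_assoc intro: permutes_compose[OF t] A)
qed

text \<open>The sets \<open>M w\<close> for \<open>w\<close> in \<open>A\<close> partition the
  permutations according to where the maximum over \<open>A\<close> is attained. By symmetry they
  all have the same size.\<close>

lemma card_permutes_max:
  fixes h :: "'a \<Rightarrow> 'b::linorder"
  assumes "finite V" "inj_on h V" "A \<subseteq> V" "u \<in> A"
  shows "real (card {p. p permutes V \<and> (\<forall>x\<in>A. h (p x) \<le> h (p u))}) =
    real (card {p. p permutes V}) * inverse (real (card A))"
proof -
  define M where "M w = {p. p permutes V \<and> (\<forall>x\<in>A. h (p x) \<le> h (p w))}" for w
  have fin: "finite A" "finite {p. p permutes V}"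
    using assms finite_subset finite_permutations by auto
  have "{p. p permutes V} = (\<Union>w\<in>A. M w)"
  proof (intro equalityI subsetI)
    fix p assume p: "p \<in> {p. p permutes V}"
    have "Max ((\<lambda>x. h (p x)) ` A) \<in> (\<lambda>x. h (p x)) ` A"
      using fin assms by (intro Max_in) auto
    then obtain w where "w \<in> A" "Max ((\<lambda>x. h (p x)) ` A) = h (p w)"
      by auto
    moreover have "h (p x) \<le> Max ((\<lambda>x. h (p x)) ` A)" if "x \<in> A" for x
      using fin that by auto
    ultimately show "p \<in> (\<Union>w\<in>A. M w)"
      using p by (auto simp: M_def)
  qed (auto simp: M_def)
  \<comment> \<open>Ties are impossible, since \<open>h\<close> is injective on \<open>V\<close> and
    \<open>p\<close> is injective.\<close>
  moreover have "M w \<inter> M w' = {}" if "w \<in> A" "w' \<in> A" "w \<noteq> w'" for w w'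
  proof (rule ccontr)
    assume "M w \<inter> M w' \<noteq> {}"
    then obtain p where "p \<in> M w" "p \<in> M w'"
      by blast
    with that have p: "p permutes V" "h (p w) = h (p w')"
      unfolding M_def by (blast, intro order.antisym) blast+
    then have "p w = p w'"
      using inj_onD[OF assms(2) p(2)] assms(3) that by (simp add: permutes_in_image subset_iff)
    with p(1) \<open>w \<noteq> w'\<close> show False
      by (auto dest: permutes_inj injD)
  qed
  ultimately have "card {p. p permutes V} = (\<Sum>w\<in>A. card (M w))"
    using fin by (simp add: card_UN_disjoint M_def)
  also have "\<dots> = (\<Sum>w\<in>A. card (M u))"
    unfolding M_def using assms by (intro sum.cong refl card_permutes_max_eq) auto
  finally have "real (card {p. p permutes V}) = real (card A) * real (card (M u))"
    by simp
  moreover have "real (card A) > 0"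
    using fin assms by (auto simp: card_gt_0_iff)
  ultimately have "real (card (M u)) = real (card {p. p permutes V}) * inverse (real (card A))"
    by simp
  then show ?thesis
    by (simp only: M_def)
qed

text \<open>Strong induction on the rank shows that the stalled closure \<open>T\<close> contains
  every vertex: if \<open>x\<close> were missing, it would be last in some
  \<open>closed_nbhd G v\<close>, all of whose other members have smaller rank and so lie in
  \<open>T\<close>. Then \<open>v\<close> could still force \<open>x\<close>.\<close>

lemma (in pair_graph) zero_forcing_set_not_last:
  fixes r :: "'a \<Rightarrow> nat"
  assumes "inj_on r (pverts G)"
  shows "zero_forcing_set G
    {u\<in>pverts G. \<forall>v\<in>nbhd G u. \<not> (\<forall>w\<in>closed_nbhd G v. r w \<le> r u)}"
    (is "zero_forcing_set G ?Z")
proof -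
  define T where "T = forcing_closure G ?Z"
  have Z: "?Z \<subseteq> pverts G"
    by auto
  have T: "(force_step G)\<^sup>*\<^sup>* ?Z T" "\<nexists>U. force_step G T U"
    using theI'[OF forcing_closure_unique[OF Z]] unfolding T_def forcing_closure_def by blast+
  have "T \<subseteq> pverts G"
    using T(1) Z by (induction rule: rtranclp_induct) (auto dest: force_step_verts(1))
  moreover have "x \<in> T" if "x \<in> pverts G" for x
    using that
  proof (induction "r x" arbitrary: x rule: less_induct)
    case less
    show ?case
    proof (rule ccontr)
      assume "x \<notin> T"
      then have "x \<notin> ?Z"
        using force_steps_mono[OF T(1)] by blast
      then obtain v where v: "v \<in> nbhd G x" "\<forall>w\<in>closed_nbhd G v. r w \<le> r x"
        using less.prems by blast
      \<comment> \<open>As \<open>v\<close> differs from \<open>x\<close>, the fact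
        \<open>mem\<close> will also apply to \<open>v\<close> itself, which has to be in
        \<open>T\<close> to force.\<close>
      have xv: "x \<in> nbhd G v" "v \<noteq> x"
        using v(1) by (auto simp: nbhd_def intro: arcs_symmetric dest: no_loops')
      have mem: "w \<in> T" if "w \<in> closed_nbhd G v" "w \<noteq> x" for w
      proof -
        have w: "w \<in> pverts G"
          using that(1) v(1) by (auto simp: closed_nbhd_def nbhd_def dest: in_arcsD2)
        then have "r w \<noteq> r x"
          using assms less.prems that(2) by (auto dest: inj_onD)
        with v(2) that(1) have "r w < r x"
          by (simp add: order.strict_iff_order)
        with w show ?thesis
          using less.hyps by blast
      qed
      have "v \<in> T" "nbhd G v - T = {x}"
        using mem xv \<open>x \<notin> T\<close> by (auto simp: closed_nbhd_def)
      then show False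
        using T(2) unfolding force_step_def by blast
    qed
  qed
  ultimately show ?thesis
    unfolding zero_forcing_set_def T_def[symmetric] using Z by blast
qed

theorem theorem3:
  fixes G :: "'a pair_pre_digraph"
  assumes "pair_graph G"
  shows "real (zero_forcing_number G) \<le>
    (\<Sum>u\<in>pverts G. \<Sum>i=0..degree G u. (-1) ^ i *
      (\<Sum>I\<in>{I. I \<subseteq> nbhd G u \<and> card I = i}.
        inverse (real (card ({u} \<union> (\<Union>v\<in>I. closed_nbhd G v))))))"
proof -
  interpret pair_graph G by fact
  let ?V = "pverts G"
  \<comment> \<open>With a fixed injective numbering \<open>h\<close>, a uniformly random
    permutation \<open>p\<close> yields the random order, ranking \<open>x\<close> by
    \<open>h (p x)\<close>.\<close>
  obtain h :: "'a \<Rightarrow> nat" where h: "inj_on h ?V"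
    using finite_imp_inj_to_nat_seg[OF pair_finite_verts] by blast
  define S where "S = {p. p permutes ?V}"
  have S: "finite S" "id \<in> S"
    unfolding S_def by (simp_all add: finite_permutations pair_finite_verts permutes_id)
  then have S_pos: "real (card S) > 0"
    by (auto simp: card_gt_0_iff)
  define last where "last u v p \<longleftrightarrow> (\<forall>w\<in>closed_nbhd G v. h (p w) \<le> h (p u))" for u v and p :: "'a \<Rightarrow> 'a"
  define Z where "Z p = {u\<in>?V. \<forall>v\<in>nbhd G u. \<not> last u v p}" for p
  have Z: "zero_forcing_number G \<le> card (Z p)" if "p \<in> S" for p
  proof -
    have "inj_on (\<lambda>x. h (p x)) ?V"
      using that h comp_inj_on[of p ?V h]
      by (simp add: S_def permutes_inj_on permutes_image comp_def)
    from zero_forcing_set_not_last[OF this] have "zero_forcing_set G (Z p)"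
      by (simp add: Z_def last_def)
    then show ?thesis
      unfolding zero_forcing_number_def by (intro Least_le) blast
  qed
  have nbhd_sub: "nbhd G u \<subseteq> ?V" for u
    by (auto simp: nbhd_def dest: in_arcsD2)
  have nbhd_fin: "finite (nbhd G u)" for u
    using nbhd_sub pair_finite_verts by (rule finite_subset)
  have count: "real (card {p\<in>S. \<forall>v\<in>I. last u v p}) =
      real (card S) * inverse (real (card ({u} \<union> (\<Union>v\<in>I. closed_nbhd G v))))"
    if "u \<in> ?V" "I \<subseteq> nbhd G u" for u I
  proof -
    let ?A = "{u} \<union> (\<Union>v\<in>I. closed_nbhd G v)"
    have "?A \<subseteq> ?V"
      using that nbhd_sub by (auto simp: closed_nbhd_def)
    from card_permutes_max[OF pair_finite_verts h this, of u]
    have "real (card {p. p permutes ?V \<and> (\<forall>x\<in>?A. h (p x) \<le> h (p u))}) =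
        real (card S) * inverse (real (card ?A))"
      by (simp add: S_def)
    \<comment> \<open>Including \<open>u\<close> in the union adds only a trivial inequality, and it
      covers empty \<open>I\<close>, where every permutation qualifies and the cardinality is
      1.\<close>
    moreover have "{p\<in>S. \<forall>v\<in>I. last u v p} =
        {p. p permutes ?V \<and> (\<forall>x\<in>?A. h (p x) \<le> h (p u))}"
      by (auto simp: S_def last_def)
    ultimately show ?thesis
      by simp
  qed
  let ?f = "\<lambda>u. \<Sum>i=0..degree G u. (-1) ^ i * (\<Sum>I\<in>{I. I \<subseteq> nbhd G u \<and> card I = i}.
        inverse (real (card ({u} \<union> (\<Union>v\<in>I. closed_nbhd G v)))))"
  \<comment> \<open>The minimum is at most the average of \<open>card (Z p)\<close>. Both sides are
    kept multiplied by \<open>card S\<close>, which is cancelled at the end.\<close>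
  have "real (card S) * real (zero_forcing_number G) = (\<Sum>p\<in>S. real (zero_forcing_number G))"
    by simp
  also have "\<dots> \<le> (\<Sum>p\<in>S. real (card (Z p)))"
    using Z by (intro sum_mono) simp
  also have "\<dots> = (\<Sum>p\<in>S. \<Sum>u\<in>?V. of_bool (\<forall>v\<in>nbhd G u. \<not> last u v p))"
    by (simp only: Z_def card_filter_conv_sum_of_bool[OF pair_finite_verts])
  also have "\<dots> = (\<Sum>u\<in>?V. real (card {p\<in>S. \<forall>v\<in>nbhd G u. \<not> last u v p}))"
    by (subst sum.swap) (simp only: card_filter_conv_sum_of_bool[OF S(1)])
  also have "\<dots> = (\<Sum>u\<in>?V. real (card S) * ?f u)"
  proof (rule sum.cong[OF refl])
    fix u assume u: "u \<in> ?V"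
    have "real (card {p\<in>S. \<forall>v\<in>nbhd G u. \<not> last u v p}) =
        (\<Sum>I\<in>Pow (nbhd G u). (-1) ^ card I * real (card {p\<in>S. \<forall>v\<in>I. last u v p}))"
      by (rule card_none_inclusion_exclusion[OF S(1) nbhd_fin])
    also have "\<dots> = real (card S) * (\<Sum>I\<in>Pow (nbhd G u). (-1) ^ card I *
        inverse (real (card ({u} \<union> (\<Union>v\<in>I. closed_nbhd G v)))))"
      unfolding sum_distrib_left by (intro sum.cong refl) (use u in \<open>simp add: count\<close>)
    also have "\<dots> = real (card S) * ?f u"
      by (simp only: sum_Pow_by_card[OF nbhd_fin, where f = "\<lambda>i. (-1) ^ i"] degree_def)
    finally show "real (card {p\<in>S. \<forall>v\<in>nbhd G u. \<not> last u v p}) = real (card S) * ?f u" .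
  qed
  also have "\<dots> = real (card S) * (\<Sum>u\<in>?V. ?f u)"
    by (rule sum_distrib_left[symmetric])
  finally show ?thesis
    using S_pos by (simp only: mult_le_cancel_left_pos)
qed

end
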